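(* Let $f\colon\mathbb R\to\mathbb R$. The composition operator $C_f$ maps $bv_1(\mathbb R)$ into itself and is Lipschitz continuous on bounded sets if and only if $f$ is differentiable on $\mathbb R$ and its derivative $f'$ satisfies a Lipschitz condition on bounded sets.
   Context: The composition operator $C_f$ assigns to a sequence $x\colon\mathbb N\to\mathbb R$ the sequence $C_f(x)$ with $C_f(x)(n)=f(x(n))$ for all $n\in\mathbb N$. $bv_1(\mathbb R)$ is the space of all sequences $x\colon\mathbb N\to\mathbb R$ with $\sum_{n=1}^\infty|x(n+1)-x(n)|<+\infty$, with norm $\|x\|_{bv_1}=|x(1)|+\sum_{n=1}^\infty|x(n+1)-x(n)|$. A map $F\colon X\to Y$ between normed spaces is Lipschitz continuous on bounded sets (satisfies a Lipschitz condition on bounded sets) if for every $r>0$ there exists $L_r\ge0$ such that $\|F(x)-F(y)\|_Y\le L_r\|x-y\|_X$ for all $x,y$ in the closed ball of $X$ with center $0$ and radius $r$. *)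

theory Defs
  imports "HOL-Analysis.Analysis"
begin

(* Sequences are indexed from 0: the entry x n here is x(n+1) in the
   convention that indexes sequences by the positive integers. *)

definition bv1 :: "(nat \<Rightarrow> real) set" where
  "bv1 = {x. summable (\<lambda>n. \<bar>x (Suc n) - x n\<bar>)}"

(* Only meaningful on bv1, since suminf is unspecified on divergent series. *)
definition norm_bv1 :: "(nat \<Rightarrow> real) \<Rightarrow> real" where
  "norm_bv1 x = \<bar>x 0\<bar> + (\<Sum>n. \<bar>x (Suc n) - x n\<bar>)"

definition comp_operator :: "(real \<Rightarrow> real) \<Rightarrow> (nat \<Rightarrow> real) \<Rightarrow> (nat \<Rightarrow> real)" where
  "comp_operator f x = (\<lambda>n. f (x n))"

(* Normed spaces are given by a carrier and a norm (NX on X, NY for the values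
   of F), because bv1 is a subset of a function type rather than a type of class
   real_normed_vector. *)
definition lipschitz_on_bounded_sets ::
  "'a::minus set \<Rightarrow> ('a \<Rightarrow> real) \<Rightarrow> ('b::minus \<Rightarrow> real) \<Rightarrow> ('a \<Rightarrow> 'b) \<Rightarrow> bool" where
  "lipschitz_on_bounded_sets X NX NY F \<longleftrightarrow>
     (\<forall>r>0. \<exists>L\<ge>0. \<forall>x\<in>X. \<forall>y\<in>X. NX x \<le> r \<longrightarrow> NX y \<le> r \<longrightarrow>
        NY (F x - F y) \<le> L * NX (x - y))"

end

theory Submission
  imports Defs
begin

text \<open>
  For the forward direction, let \<open>C\<^sub>f\<close> act on a sequence that alternates \<open>N\<close> times between
  \<open>a\<close> and \<open>b\<close> and on its translate by \<open>h\<close>. The translate is at distance \<open>\<bar>h\<bar>\<close>, while the images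
  are at distance at least \<open>N \<bar>f (b + h) - f b - f (a + h) + f a\<bar>\<close>. Taking \<open>N\<close> of order
  \<open>1 / \<bar>a - b\<bar>\<close> keeps both sequences in a fixed ball, so on bounded sets
  \<open>\<bar>f (b + h) - f b - f (a + h) + f a\<bar> \<le> K \<bar>h\<bar> \<bar>a - b\<bar>\<close>. With an antiderivative of \<open>f\<close> this
  yields that the difference quotients of \<open>f\<close> at a point with steps \<open>h\<close> and \<open>s\<close> differ by at most
  \<open>K (\<bar>h\<bar> + \<bar>s\<bar>)\<close>, hence converge; the limits inherit the Lipschitz bound. Conversely, the
  mean value theorem applied to \<open>f (c + t (a - c)) - f (d + t (b - d))\<close> bounds the variation
  of \<open>C\<^sub>f x - C\<^sub>f y\<close> termwise.
\<close>

section \<open>Elementary properties of the norm on \<open>bv1\<close>\<close>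

lemma norm_bv1_nonneg: "x \<in> bv1 \<Longrightarrow> 0 \<le> norm_bv1 x"
  by (simp add: norm_bv1_def bv1_def suminf_nonneg)

text \<open>Telescoping from the first entry. A norm ball of radius r thus contains only sequences
  with values in [-r, r], where the local bounds on \<open>f\<close> apply.\<close>

lemma abs_le_norm_bv1:
  assumes "x \<in> bv1"
  shows "\<bar>x n\<bar> \<le> norm_bv1 x"
proof -
  have "\<bar>x n - x 0\<bar> = \<bar>\<Sum>i<n. x (Suc i) - x i\<bar>"
    by (simp add: sum_lessThan_telescope)
  also have "\<dots> \<le> (\<Sum>i<n. \<bar>x (Suc i) - x i\<bar>)"
    by (rule sum_abs)
  also have "\<dots> \<le> (\<Sum>i. \<bar>x (Suc i) - x i\<bar>)"
    using assms by (intro sum_le_suminf) (auto simp: bv1_def)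
  finally show ?thesis
    by (simp add: norm_bv1_def)
qed

lemma variation_le_norm_bv1: "(\<Sum>n. \<bar>x (Suc n) - x n\<bar>) \<le> norm_bv1 x"
  by (simp add: norm_bv1_def)

lemma bv1_diff:
  assumes "x \<in> bv1" "y \<in> bv1"
  shows "x - y \<in> bv1"
proof -
  have "summable (\<lambda>n. \<bar>x (Suc n) - x n\<bar> + \<bar>y (Suc n) - y n\<bar>)"
    using assms by (auto simp: bv1_def intro: summable_add)
  then have "summable (\<lambda>n. \<bar>(x - y) (Suc n) - (x - y) n\<bar>)"
    by (rule summable_comparison_test'[where N = 0]) (simp add: abs_if)
  then show ?thesis
    by (simp add: bv1_def)
qed

section \<open>Alternating test sequences\<close>

text \<open>The \<open>min\<close> freezes the sequence from index \<open>N\<close> on: it makes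
  exactly \<open>N\<close> jumps, so its variation is finite and grows with \<open>N\<close> while
  its values stay in {a, b}.\<close>

definition zigzag :: "real \<Rightarrow> real \<Rightarrow> nat \<Rightarrow> nat \<Rightarrow> real" where
  "zigzag a b N n = (if odd (min n N) then b else a)"

lemma zigzag_step: "\<bar>zigzag a b N (Suc n) - zigzag a b N n\<bar> = (if n < N then \<bar>b - a\<bar> else 0)"
  by (auto simp: zigzag_def min_def abs_minus_commute le_Suc_eq not_le)

lemma zigzag_in_bv1: "zigzag a b N \<in> bv1"
  by (simp add: bv1_def zigzag_step)

lemma norm_bv1_zigzag: "norm_bv1 (zigzag a b N) = \<bar>a\<bar> + real N * \<bar>b - a\<bar>"
proof -
  have "(\<Sum>n. if n < N then \<bar>b - a\<bar> else 0) = (\<Sum>n<N. if n < N then \<bar>b - a\<bar> else 0)"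
    by (rule suminf_finite) auto
  then show ?thesis
    by (simp add: norm_bv1_def zigzag_step) (simp add: zigzag_def)
qed

text \<open>For fixed \<open>N\<close> the family is stable under differences and, by the next
  lemma, under composition with \<open>f\<close>. A norm inequality between images of zigzags
  therefore becomes a scalar inequality.\<close>

lemma zigzag_diff: "zigzag a b N - zigzag c d N = zigzag (a - c) (b - d) N"
  by (auto simp: zigzag_def)

lemma comp_operator_zigzag: "comp_operator f (zigzag a b N) = zigzag (f a) (f b) N"
  by (auto simp: zigzag_def comp_operator_def)

section \<open>Second differences controlled by the operator\<close>

text \<open>A derivative-free substitute for a Lipschitz condition on the derivative: dividing by
  \<open>h\<close> and letting it tend to 0 recovers that condition with the same constant in the
  interior of the ball.\<close>

definition second_difference_bounded :: "(real \<Rightarrow> real) \<Rightarrow> real \<Rightarrow> real \<Rightarrow> bool" where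
  "second_difference_bounded f r K \<longleftrightarrow>
     (\<forall>a b h. \<bar>a\<bar> \<le> r \<longrightarrow> \<bar>b\<bar> \<le> r \<longrightarrow> \<bar>a + h\<bar> \<le> r \<longrightarrow> \<bar>b + h\<bar> \<le> r \<longrightarrow>
        \<bar>(f (b + h) - f b) - (f (a + h) - f a)\<bar> \<le> K * \<bar>h\<bar> * \<bar>b - a\<bar>)"

lemma second_difference_boundedD:
  assumes "second_difference_bounded f r K"
    and "\<bar>a\<bar> \<le> r" "\<bar>b\<bar> \<le> r" "\<bar>a + h\<bar> \<le> r" "\<bar>b + h\<bar> \<le> r"
  shows "\<bar>(f (b + h) - f b) - (f (a + h) - f a)\<bar> \<le> K * \<bar>h\<bar> * \<bar>b - a\<bar>"
  using assms unfolding second_difference_bounded_def by blast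

text \<open>One Lipschitz constant of the operator serves for both bounds: constant sequences give
  the first, zigzags with many jumps the second.\<close>

lemma second_difference_bound:
  fixes f :: "real \<Rightarrow> real"
  assumes "lipschitz_on_bounded_sets bv1 norm_bv1 norm_bv1 (comp_operator f)" and "r > 0"
  shows "\<exists>K\<ge>0. (\<forall>a c. \<bar>a\<bar> \<le> r \<longrightarrow> \<bar>c\<bar> \<le> r \<longrightarrow> \<bar>f a - f c\<bar> \<le> K * \<bar>a - c\<bar>)
    \<and> second_difference_bounded f r K"
proof -
  \<comment> \<open>The radius \<open>3 * r + 1\<close> fits the test sequences: the first entry
    takes up at most \<open>r\<close>, the variation at most \<open>1 + 2 * r\<close>.\<close>
  obtain K where K: "K \<ge> 0"
    and lip: "\<And>x y. x \<in> bv1 \<Longrightarrow> y \<in> bv1 \<Longrightarrow> norm_bv1 x \<le> 3 * r + 1 \<Longrightarrow> norm_bv1 y \<le> 3 * r + 1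
      \<Longrightarrow> norm_bv1 (comp_operator f x - comp_operator f y) \<le> K * norm_bv1 (x - y)"
    using assms unfolding lipschitz_on_bounded_sets_def
    by (metis add_pos_pos mult_pos_pos zero_less_numeral zero_less_one)
  have zz: "\<bar>f a - f c\<bar> + real N * \<bar>(f b - f d) - (f a - f c)\<bar>
      \<le> K * (\<bar>a - c\<bar> + real N * \<bar>(b - d) - (a - c)\<bar>)"
    if "\<bar>a\<bar> + real N * \<bar>b - a\<bar> \<le> 3 * r + 1" "\<bar>c\<bar> + real N * \<bar>d - c\<bar> \<le> 3 * r + 1" for a b c d N
    using lip[OF zigzag_in_bv1[of a b N] zigzag_in_bv1[of c d N]] that
    by (simp add: comp_operator_zigzag zigzag_diff norm_bv1_zigzag)
  show ?thesis
  proof (intro exI conjI allI impI)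
    show "K \<ge> 0" by (rule K)
    show "\<bar>f a - f c\<bar> \<le> K * \<bar>a - c\<bar>" if "\<bar>a\<bar> \<le> r" "\<bar>c\<bar> \<le> r" for a c
      \<comment> \<open>Zero jumps, that is, two constant sequences.\<close>
      using zz[of a 0 a c c] that \<open>r > 0\<close> by simp
    have "\<bar>(f (b + h) - f b) - (f (a + h) - f a)\<bar> \<le> K * \<bar>h\<bar> * \<bar>b - a\<bar>"
      if bd: "\<bar>a\<bar> \<le> r" "\<bar>b\<bar> \<le> r" "\<bar>a + h\<bar> \<le> r" "\<bar>b + h\<bar> \<le> r" for a b h
    proof (cases "a = b")
      case False
      \<comment> \<open>The least number of jumps whose total variation reaches 1; rounding up
        overshoots by at most one jump, hence by at most \<open>2 * r\<close>.\<close>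
      define N where "N = nat \<lceil>1 / \<bar>b - a\<bar>\<rceil>"
      have "1 / \<bar>b - a\<bar> \<le> real N"
        unfolding N_def by linarith
      then have N1: "1 \<le> real N * \<bar>b - a\<bar>"
        using False by (simp add: field_simps)
      have "real N \<le> 1 / \<bar>b - a\<bar> + 1"
        unfolding N_def using False by (simp add: of_nat_nat ceiling_correct)
      then have "real N * \<bar>b - a\<bar> \<le> (1 / \<bar>b - a\<bar> + 1) * \<bar>b - a\<bar>"
        by (intro mult_right_mono) auto
      also have "\<dots> = 1 + \<bar>b - a\<bar>"
        using False by (simp add: field_simps)
      finally have N2: "real N * \<bar>b - a\<bar> \<le> 1 + 2 * r"
        using bd by linarith
      let ?S = "\<bar>(f (b + h) - f b) - (f (a + h) - f a)\<bar>"
      \<comment> \<open>The two zigzags differ by the constant \<open>h\<close>, so \<open>N\<close>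
        multiplies 0 on the right of \<open>zz\<close> but the second difference on the left. Since
        \<open>N * \<bar>b - a\<bar>\<close> is at least 1, multiplying by
        \<open>\<bar>b - a\<bar>\<close> then removes \<open>N\<close>.\<close>
      have "real N * ?S \<le> K * \<bar>h\<bar>"
        using zz[of "a + h" N "b + h" a b] N2 bd by (simp, smt (verit))
      then have "real N * ?S * \<bar>b - a\<bar> \<le> K * \<bar>h\<bar> * \<bar>b - a\<bar>"
        by (rule mult_right_mono) simp
      moreover have "?S * 1 \<le> ?S * (real N * \<bar>b - a\<bar>)"
        using N1 by (intro mult_left_mono) auto
      ultimately show ?thesis
        by (simp add: mult_ac)
    qed simp
    then show "second_difference_bounded f r K"
      by (simp add: second_difference_bounded_def)
  qed
qed

section \<open>Differentiability from the second-difference bound\<close>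

text \<open>Both sides equal the mixed second difference
  \<open>\<Phi> (a + h + s) - \<Phi> (a + h) - \<Phi> (a + s) + \<Phi> a\<close> of an antiderivative \<open>\<Phi>\<close> of \<open>f\<close>.\<close>

lemma mixed_mean_value:
  fixes f :: "real \<Rightarrow> real"
  assumes "continuous_on UNIV f"
  obtains \<xi> \<eta> where "0 < \<xi>" "\<xi> < 1" "0 < \<eta>" "\<eta> < 1"
    and "s * (f (a + h + \<xi> * s) - f (a + \<xi> * s)) = h * (f (a + s + \<eta> * h) - f (a + \<eta> * h))"
proof -
  \<comment> \<open>All points used below lie within \<open>\<bar>h\<bar> + \<bar>s\<bar>\<close> of
    \<open>a\<close>. The extra 1 makes them interior, so the derivative within the interval is a
    genuine derivative.\<close>
  define c where "c = \<bar>h\<bar> + \<bar>s\<bar> + 1"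
  obtain \<Phi> where \<Phi>: "\<And>x. x \<in> {a - c..a + c} \<Longrightarrow>
      (\<Phi> has_vector_derivative f x) (at x within {a - c..a + c})"
    using antiderivative_continuous[of "a - c" "a + c" f] assms continuous_on_subset by blast
  have \<Phi>': "(\<Phi> has_real_derivative f x) (at x)" if "\<bar>x - a\<bar> < c" for x
  proof -
    have "x \<in> interior {a - c..a + c}"
      using that by (auto simp: interior_atLeastAtMost_real)
    then have "at x within {a - c..a + c} = at x" "x \<in> {a - c..a + c}"
      by (rule at_within_interior) (use that in auto)
    then show ?thesis
      using \<Phi>[of x] by (simp add: has_real_derivative_iff_has_vector_derivative)
  qed
  \<comment> \<open>The left side is symmetric in \<open>u\<close> and \<open>v\<close>; the mean
    value theorem along \<open>v\<close> treats them differently. Using it for (h, s) and for (s, h)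
    gives the two sides of the identity.\<close>
  have mv: "\<exists>z>0. z < 1 \<and> (\<Phi> (a + u + v) - \<Phi> (a + v)) - (\<Phi> (a + u) - \<Phi> a)
      = v * (f (a + u + z * v) - f (a + z * v))" if uv: "\<bar>u\<bar> + \<bar>v\<bar> < c" for u v
  proof -
    have "((\<lambda>t. \<Phi> (a + u + t * v) - \<Phi> (a + t * v)) has_real_derivative
        v * (f (a + u + t * v) - f (a + t * v))) (at t)" if t: "0 \<le> t" "t \<le> 1" for t
    proof -
      have "\<bar>t * v\<bar> \<le> \<bar>v\<bar>"
        using t by (simp add: abs_mult mult_left_le_one_le)
      then have "\<bar>(a + u + t * v) - a\<bar> < c" "\<bar>(a + t * v) - a\<bar> < c"
        using uv by linarith+
      note \<Phi>'[OF this(1)] \<Phi>'[OF this(2)]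
      then show ?thesis
        by (auto intro!: derivative_eq_intros DERIV_chain2[of \<Phi>] simp: algebra_simps)
    qed
    from MVT2[OF zero_less_one this] show ?thesis
      by auto
  qed
  obtain \<xi> where "0 < \<xi>" "\<xi> < 1" and \<xi>: "(\<Phi> (a + h + s) - \<Phi> (a + s)) - (\<Phi> (a + h) - \<Phi> a)
      = s * (f (a + h + \<xi> * s) - f (a + \<xi> * s))"
    using mv[of h s] unfolding c_def by auto
  moreover obtain \<eta> where "0 < \<eta>" "\<eta> < 1"
    and \<eta>: "(\<Phi> (a + s + h) - \<Phi> (a + h)) - (\<Phi> (a + s) - \<Phi> a)
      = h * (f (a + s + \<eta> * h) - f (a + \<eta> * h))"
    using mv[of s h] unfolding c_def by auto
  moreover have "s * (f (a + h + \<xi> * s) - f (a + \<xi> * s)) = h * (f (a + s + \<eta> * h) - f (a + \<eta> * h))"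
    unfolding \<xi>[symmetric] \<eta>[symmetric] by (simp add: add_ac)
  ultimately show ?thesis
    by (rule_tac that)
qed

text \<open>A Cauchy criterion: the quotients converge along one null sequence of steps, and the
  hypothesis then compares every other small step with that limit.\<close>

lemma has_derivative_if_quotients_close:
  fixes f :: "real \<Rightarrow> real"
  assumes "d > 0" "K \<ge> 0"
    and close: "\<And>h s. h \<noteq> 0 \<Longrightarrow> s \<noteq> 0 \<Longrightarrow> \<bar>h\<bar> \<le> d \<Longrightarrow> \<bar>s\<bar> \<le> d \<Longrightarrow>
      \<bar>(f (a + h) - f a) / h - (f (a + s) - f a) / s\<bar> \<le> K * (\<bar>h\<bar> + \<bar>s\<bar>)"
  obtains D where "(f has_real_derivative D) (at a)"
proof -
  define q where "q h = (f (a + h) - f a) / h" for h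
  \<comment> \<open>\<open>Suc n\<close> keeps every step nonzero; at index 0 the term
    \<open>d / real n\<close> would be \<open>d / 0 = 0\<close>.\<close>
  define u where "u n = d / real (Suc n)" for n
  have u: "u n \<noteq> 0" "\<bar>u n\<bar> \<le> d" for n
    using \<open>d > 0\<close> by (simp_all add: u_def divide_simps)
  have u0: "u \<longlonglongrightarrow> 0"
    unfolding u_def using lim_const_over_n[of d] by (rule LIMSEQ_Suc)
  have "Cauchy (\<lambda>n. q (u n))"
  proof (rule metric_CauchyI)
    fix e :: real
    assume "e > 0"
    have "(\<lambda>n. K * \<bar>u n\<bar>) \<longlonglongrightarrow> 0"
      using u0 by (auto intro!: tendsto_eq_intros)
    then have "\<forall>\<^sub>F n in sequentially. K * \<bar>u n\<bar> < e / 2"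
      using \<open>e > 0\<close> by (intro order_tendstoD(2)) auto
    then obtain M where M: "\<And>n. n \<ge> M \<Longrightarrow> K * \<bar>u n\<bar> < e / 2"
      by (auto simp: eventually_sequentially)
    have "dist (q (u m)) (q (u n)) < e" if "m \<ge> M" "n \<ge> M" for m n
      using close[of "u m" "u n"] u M[OF that(1)] M[OF that(2)]
      by (simp add: dist_real_def q_def distrib_left)
    then show "\<exists>M. \<forall>m\<ge>M. \<forall>n\<ge>M. dist (q (u m)) (q (u n)) < e"
      by blast
  qed
  then obtain D where D: "(\<lambda>n. q (u n)) \<longlonglongrightarrow> D"
    using Cauchy_convergent convergent_def by blast
  \<comment> \<open>Fix \<open>s\<close> in \<open>close\<close> and let the other step run through
    \<open>u n\<close>.\<close>
  have bound: "\<bar>q s - D\<bar> \<le> K * \<bar>s\<bar>" if "s \<noteq> 0" "\<bar>s\<bar> \<le> d" for s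
  proof (rule LIMSEQ_le)
    show "(\<lambda>n. \<bar>q s - q (u n)\<bar>) \<longlonglongrightarrow> \<bar>q s - D\<bar>"
      using D by (intro tendsto_intros)
    show "(\<lambda>n. K * (\<bar>s\<bar> + \<bar>u n\<bar>)) \<longlonglongrightarrow> K * \<bar>s\<bar>"
      using u0 by (auto intro!: tendsto_eq_intros)
    show "\<exists>N. \<forall>n\<ge>N. \<bar>q s - q (u n)\<bar> \<le> K * (\<bar>s\<bar> + \<bar>u n\<bar>)"
      using close[of s] that u unfolding q_def by blast
  qed
  have "((\<lambda>s. q s - D) \<longlongrightarrow> 0) (at 0)"
  proof (rule Lim_null_comparison)
    show "\<forall>\<^sub>F s in at 0. norm (q s - D) \<le> K * \<bar>s\<bar>"
      unfolding eventually_at using \<open>d > 0\<close> bound by (auto intro!: exI[of _ d])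
    show "((\<lambda>s. K * \<bar>s\<bar>) \<longlongrightarrow> 0) (at 0)"
      by (auto intro!: tendsto_eq_intros)
  qed
  then have "(q \<longlongrightarrow> D) (at 0)"
    by (rule LIM_zero_cancel)
  then have "(f has_real_derivative D) (at a)"
    unfolding DERIV_def q_def by simp
  then show ?thesis
    by (rule that)
qed

text \<open>Divided by \<open>h * s\<close>, the mixed mean value identity equates the quotient with
  step \<open>h\<close> at \<open>a + \<xi> * s\<close> with the quotient with step \<open>s\<close>
  at \<open>a + \<eta> * h\<close>. Moving the two base points back to \<open>a\<close> costs
  \<open>K * \<bar>s\<bar>\<close> and \<open>K * \<bar>h\<bar>\<close>.\<close>

lemma has_derivative_if_second_difference_bound:
  fixes f :: "real \<Rightarrow> real"
  assumes cont: "continuous_on UNIV f" and "K \<ge> 0" and "\<bar>a\<bar> < r"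
    and sd: "second_difference_bounded f r K"
  obtains D where "(f has_real_derivative D) (at a)"
proof (rule has_derivative_if_quotients_close)
  \<comment> \<open>Half the distance to the boundary: a shift of the base point and a step, each at
    most \<open>d\<close>, together stay in the ball.\<close>
  define d where "d = (r - \<bar>a\<bar>) / 2"
  show "d > 0" "K \<ge> 0"
    using assms by (auto simp: d_def)
  fix h s :: real
  assume hs: "h \<noteq> 0" "s \<noteq> 0" "\<bar>h\<bar> \<le> d" "\<bar>s\<bar> \<le> d"
  have shift: "\<bar>(f (a + \<zeta> * v + u) - f (a + \<zeta> * v)) / u - (f (a + u) - f a) / u\<bar> \<le> K * \<bar>v\<bar>"
    if \<zeta>: "0 < \<zeta>" "\<zeta> < 1" and uv: "u \<noteq> 0" "\<bar>u\<bar> \<le> d" "\<bar>v\<bar> \<le> d" for \<zeta> u v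
  proof -
    have \<zeta>v: "\<bar>\<zeta> * v\<bar> \<le> \<bar>v\<bar>"
      using \<zeta> by (simp add: abs_mult mult_left_le_one_le)
    have "\<bar>\<zeta> * v\<bar> + \<bar>u\<bar> \<le> d + d"
      using \<zeta>v uv by (intro add_mono) auto
    then have room: "\<bar>a\<bar> + \<bar>\<zeta> * v\<bar> + \<bar>u\<bar> \<le> r"
      by (simp add: d_def)
    have "\<bar>(f (a + \<zeta> * v + u) - f (a + \<zeta> * v)) - (f (a + u) - f a)\<bar>
        \<le> K * \<bar>u\<bar> * \<bar>(a + \<zeta> * v) - a\<bar>"
      using room by (intro second_difference_boundedD[OF sd]) linarith+
    also have "\<dots> \<le> K * \<bar>u\<bar> * \<bar>v\<bar>"
      using \<zeta>v \<open>K \<ge> 0\<close> by (intro mult_left_mono) auto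
    finally have "\<bar>(f (a + \<zeta> * v + u) - f (a + \<zeta> * v)) - (f (a + u) - f a)\<bar> / \<bar>u\<bar> \<le> K * \<bar>v\<bar>"
      using uv by (simp add: divide_simps mult_ac)
    then show ?thesis
      by (simp only: diff_divide_distrib[symmetric] abs_divide)
  qed
  obtain \<xi> \<eta> where \<xi>\<eta>: "0 < \<xi>" "\<xi> < 1" "0 < \<eta>" "\<eta> < 1"
    and eq: "s * (f (a + h + \<xi> * s) - f (a + \<xi> * s)) = h * (f (a + s + \<eta> * h) - f (a + \<eta> * h))"
    using mixed_mean_value[OF cont] by metis
  have "(f (a + \<xi> * s + h) - f (a + \<xi> * s)) / h = (f (a + \<eta> * h + s) - f (a + \<eta> * h)) / s"
    using eq hs by (simp add: frac_eq_eq add_ac mult_ac)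
  then show "\<bar>(f (a + h) - f a) / h - (f (a + s) - f a) / s\<bar> \<le> K * (\<bar>h\<bar> + \<bar>s\<bar>)"
    using shift[of \<xi> h s] shift[of \<eta> s h] hs \<xi>\<eta> by (simp add: distrib_left)
qed (rule that)

text \<open>Divide the bound by \<open>\<bar>h\<bar>\<close> and pass to the limit; the strict
  bounds on \<open>a\<close> and \<open>b\<close> leave room for small \<open>h\<close>.\<close>

lemma derivative_lipschitz_if_second_difference_bound:
  fixes f :: "real \<Rightarrow> real"
  assumes "(f has_real_derivative A) (at a)" "(f has_real_derivative B) (at b)"
    and ab: "\<bar>a\<bar> < r" "\<bar>b\<bar> < r"
    and sd: "second_difference_bounded f r K"
  shows "\<bar>B - A\<bar> \<le> K * \<bar>b - a\<bar>"
proof (rule tendsto_upperbound)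
  show "((\<lambda>h. \<bar>(f (b + h) - f b) / h - (f (a + h) - f a) / h\<bar>) \<longlongrightarrow> \<bar>B - A\<bar>) (at 0)"
    using assms(1,2) unfolding DERIV_def by (intro tendsto_intros)
  define d where "d = min (r - \<bar>a\<bar>) (r - \<bar>b\<bar>)"
  have "\<bar>(f (b + h) - f b) / h - (f (a + h) - f a) / h\<bar> \<le> K * \<bar>b - a\<bar>"
    if h: "h \<noteq> 0" "\<bar>h\<bar> < d" for h
  proof -
    have "\<bar>(f (b + h) - f b) - (f (a + h) - f a)\<bar> \<le> K * \<bar>h\<bar> * \<bar>b - a\<bar>"
      using h ab unfolding d_def by (intro second_difference_boundedD[OF sd]) linarith+
    then have "\<bar>(f (b + h) - f b) - (f (a + h) - f a)\<bar> / \<bar>h\<bar> \<le> K * \<bar>b - a\<bar>"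
      using h by (simp add: divide_simps mult_ac)
    then show ?thesis
      by (simp only: diff_divide_distrib[symmetric] abs_divide)
  qed
  moreover have "d > 0"
    using ab by (simp add: d_def)
  ultimately show "\<forall>\<^sub>F h in at 0. \<bar>(f (b + h) - f b) / h - (f (a + h) - f a) / h\<bar> \<le> K * \<bar>b - a\<bar>"
    unfolding eventually_at by (auto intro!: exI[of _ d])
qed simp

text \<open>Continuity comes first, because the antiderivative rests on it. Each radius is enlarged
  by 1 so that the points concerned are interior to the ball.\<close>

lemma differentiable_if_comp_operator_lipschitz:
  fixes f :: "real \<Rightarrow> real"
  assumes lip: "lipschitz_on_bounded_sets bv1 norm_bv1 norm_bv1 (comp_operator f)"
  shows "f differentiable_on UNIV" "lipschitz_on_bounded_sets UNIV norm norm (deriv f)"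
proof -
  have "isCont f a" for a
  proof -
    have "\<bar>a\<bar> + 1 > 0" by linarith
    then obtain K where K: "\<And>b c. \<bar>b\<bar> \<le> \<bar>a\<bar> + 1 \<Longrightarrow> \<bar>c\<bar> \<le> \<bar>a\<bar> + 1 \<Longrightarrow> \<bar>f b - f c\<bar> \<le> K * \<bar>b - c\<bar>"
      using second_difference_bound[OF lip] by blast
    have "((\<lambda>x. f x - f a) \<longlongrightarrow> 0) (at a)"
    proof (rule Lim_null_comparison)
      show "\<forall>\<^sub>F x in at a. norm (f x - f a) \<le> K * \<bar>x - a\<bar>"
        unfolding eventually_at by (rule exI[of _ 1]) (auto simp: dist_real_def intro!: K)
      show "((\<lambda>x. K * \<bar>x - a\<bar>) \<longlongrightarrow> 0) (at a)"
        by (auto intro!: tendsto_eq_intros)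
    qed
    then show ?thesis
      unfolding isCont_def by (rule LIM_zero_cancel)
  qed
  then have cont: "continuous_on UNIV f"
    by (simp add: continuous_at_imp_continuous_on)
  have diff: "f differentiable at a" for a
  proof -
    have "\<bar>a\<bar> + 1 > 0" by linarith
    then obtain K where "K \<ge> 0" and sd: "second_difference_bounded f (\<bar>a\<bar> + 1) K"
      using second_difference_bound[OF lip] by blast
    obtain D where "(f has_real_derivative D) (at a)"
      using has_derivative_if_second_difference_bound[OF cont \<open>K \<ge> 0\<close> _ sd, of a] by auto
    then show ?thesis
      by (auto simp: real_differentiable_def)
  qed
  then show "f differentiable_on UNIV"
    by (simp add: differentiable_on_def)
  have deriv: "(f has_real_derivative deriv f a) (at a)" for a
    using diff by (simp add: DERIV_deriv_iff_real_differentiable)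
  show "lipschitz_on_bounded_sets UNIV norm norm (deriv f)"
    unfolding lipschitz_on_bounded_sets_def
  proof (intro allI impI)
    fix r :: real
    assume "r > 0"
    then have "r + 1 > 0" by simp
    then obtain K where "K \<ge> 0" and sd: "second_difference_bounded f (r + 1) K"
      using second_difference_bound[OF lip] by blast
    have "\<bar>deriv f x - deriv f y\<bar> \<le> K * \<bar>x - y\<bar>" if "\<bar>x\<bar> \<le> r" "\<bar>y\<bar> \<le> r" for x y
      using derivative_lipschitz_if_second_difference_bound[OF deriv deriv _ _ sd, of y x] that by simp
    then show "\<exists>L\<ge>0. \<forall>x\<in>UNIV. \<forall>y\<in>UNIV. norm x \<le> r \<longrightarrow> norm y \<le> r \<longrightarrow>
        norm (deriv f x - deriv f y) \<le> L * norm (x - y)"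
      using \<open>K \<ge> 0\<close> by auto
  qed
qed

section \<open>Local estimates from a Lipschitz derivative\<close>

lemma lipschitz_if_derivative_bound:
  fixes f :: "real \<Rightarrow> real"
  assumes deriv: "\<And>x. (f has_real_derivative f' x) (at x)"
    and bd: "\<And>x. \<bar>x\<bar> \<le> r \<Longrightarrow> \<bar>f' x\<bar> \<le> M"
    and "\<bar>a\<bar> \<le> r" "\<bar>b\<bar> \<le> r"
  shows "\<bar>f a - f b\<bar> \<le> M * \<bar>a - b\<bar>"
proof -
  have "norm (f a - f b) \<le> M * norm (a - b)"
  proof (rule field_differentiable_bound[where S = "{-r..r}" and f' = f'])
    show "(f has_field_derivative f' z) (at z within {-r..r})" for z
      using deriv by (rule has_field_derivative_at_within)
  qed (use assms in \<open>auto simp: abs_le_iff\<close>)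
  then show ?thesis
    by simp
qed

text \<open>Both segments, from \<open>c\<close> to \<open>a\<close> and from \<open>d\<close> to
  \<open>b\<close>, are traversed with the same parameter. The mean value theorem then yields one
  \<open>t\<close> for both, so \<open>u - v\<close> is a convex combination of \<open>c - d\<close>
  and \<open>a - b\<close>.\<close>

lemma second_difference_le:
  fixes f :: "real \<Rightarrow> real"
  assumes deriv: "\<And>x. (f has_real_derivative f' x) (at x)"
    and bd: "\<And>x. \<bar>x\<bar> \<le> r \<Longrightarrow> \<bar>f' x\<bar> \<le> M"
    and lip: "\<And>x y. \<bar>x\<bar> \<le> r \<Longrightarrow> \<bar>y\<bar> \<le> r \<Longrightarrow> \<bar>f' x - f' y\<bar> \<le> L * \<bar>x - y\<bar>"
    and "L \<ge> 0"
    and abcd: "\<bar>a\<bar> \<le> r" "\<bar>b\<bar> \<le> r" "\<bar>c\<bar> \<le> r" "\<bar>d\<bar> \<le> r"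
  shows "\<bar>(f a - f c) - (f b - f d)\<bar>
    \<le> M * \<bar>(a - c) - (b - d)\<bar> + L * (\<bar>a - b\<bar> + \<bar>c - d\<bar>) * \<bar>b - d\<bar>"
proof -
  have "((\<lambda>t. f (c + t * (a - c)) - f (d + t * (b - d))) has_real_derivative
      f' (c + t * (a - c)) * (a - c) - f' (d + t * (b - d)) * (b - d)) (at t)" for t
    by (auto intro!: derivative_eq_intros DERIV_chain2[OF deriv])
  from MVT2[OF zero_less_one this] obtain t where t: "0 < t" "t < 1"
    and eq: "(f a - f b) - (f c - f d)
      = f' (c + t * (a - c)) * (a - c) - f' (d + t * (b - d)) * (b - d)"
    by auto
  define u v where "u = c + t * (a - c)" and "v = d + t * (b - d)"
  \<comment> \<open>Used with \<open>m = r\<close> for \<open>u\<close> and \<open>v\<close>, and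
    again with \<open>m = \<bar>a - b\<bar> + \<bar>c - d\<bar>\<close> for
    \<open>u - v\<close>.\<close>
  have conv: "\<bar>p + t * (q - p)\<bar> \<le> m" if "\<bar>p\<bar> \<le> m" "\<bar>q\<bar> \<le> m" for p q m
  proof -
    have "p + t * (q - p) = (1 - t) * p + t * q"
      by (simp add: algebra_simps)
    also have "\<bar>\<dots>\<bar> \<le> (1 - t) * \<bar>p\<bar> + t * \<bar>q\<bar>"
      using t abs_triangle_ineq[of "(1 - t) * p" "t * q"] by (simp add: abs_mult)
    also have "\<dots> \<le> (1 - t) * m + t * m"
      using t that by (intro add_mono mult_left_mono) auto
    finally show ?thesis
      by (simp add: algebra_simps)
  qed
  have uv: "\<bar>u\<bar> \<le> r" "\<bar>v\<bar> \<le> r"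
    using conv abcd unfolding u_def v_def by auto
  have "u - v = (c - d) + t * ((a - b) - (c - d))"
    unfolding u_def v_def by (simp add: algebra_simps)
  also have "\<bar>\<dots>\<bar> \<le> \<bar>a - b\<bar> + \<bar>c - d\<bar>"
    by (rule conv) auto
  finally have diff: "\<bar>u - v\<bar> \<le> \<bar>a - b\<bar> + \<bar>c - d\<bar>" .
  \<comment> \<open>Add and subtract \<open>f' u * (b - d)\<close>: the bound on \<open>f'\<close>
    handles the first product, its Lipschitz condition the second.\<close>
  have "(f a - f c) - (f b - f d) = f' u * ((a - c) - (b - d)) + (f' u - f' v) * (b - d)"
    using eq unfolding u_def[symmetric] v_def[symmetric] by (simp add: algebra_simps)
  also have "\<bar>\<dots>\<bar> \<le> \<bar>f' u\<bar> * \<bar>(a - c) - (b - d)\<bar> + \<bar>f' u - f' v\<bar> * \<bar>b - d\<bar>"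
    by (metis abs_mult abs_triangle_ineq)
  also have "\<dots> \<le> M * \<bar>(a - c) - (b - d)\<bar> + L * (\<bar>a - b\<bar> + \<bar>c - d\<bar>) * \<bar>b - d\<bar>"
  proof (intro add_mono mult_right_mono)
    show "\<bar>f' u\<bar> \<le> M"
      using bd uv by blast
    have "\<bar>f' u - f' v\<bar> \<le> L * \<bar>u - v\<bar>"
      using lip uv by blast
    also have "\<dots> \<le> L * (\<bar>a - b\<bar> + \<bar>c - d\<bar>)"
      using diff \<open>L \<ge> 0\<close> by (rule mult_left_mono)
    finally show "\<bar>f' u - f' v\<bar> \<le> L * (\<bar>a - b\<bar> + \<bar>c - d\<bar>)" .
  qed auto
  finally show ?thesis .
qed

section \<open>The composition operator on \<open>bv1\<close>\<close>

lemma comp_operator_bv1: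
  assumes loc: "\<And>r. r > 0 \<Longrightarrow> \<exists>M. \<forall>a b. \<bar>a\<bar> \<le> r \<longrightarrow> \<bar>b\<bar> \<le> r \<longrightarrow> \<bar>f a - f b\<bar> \<le> M * \<bar>a - b\<bar>"
    and x: "x \<in> bv1"
  shows "comp_operator f x \<in> bv1"
proof -
  \<comment> \<open>The added 1 gives a positive radius even for the zero sequence.\<close>
  have "norm_bv1 x + 1 > 0"
    using norm_bv1_nonneg[OF x] by simp
  from loc[OF this] obtain M where M: "\<And>a b. \<bar>a\<bar> \<le> norm_bv1 x + 1 \<Longrightarrow> \<bar>b\<bar> \<le> norm_bv1 x + 1
      \<Longrightarrow> \<bar>f a - f b\<bar> \<le> M * \<bar>a - b\<bar>"
    by blast
  have "summable (\<lambda>n. M * \<bar>x (Suc n) - x n\<bar>)"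
    using x by (auto simp: bv1_def intro: summable_mult)
  then have "summable (\<lambda>n. \<bar>f (x (Suc n)) - f (x n)\<bar>)"
  proof (rule summable_comparison_test'[where N = 0])
    show "norm \<bar>f (x (Suc n)) - f (x n)\<bar> \<le> M * \<bar>x (Suc n) - x n\<bar>" for n
      using M[of "x (Suc n)" "x n"] abs_le_norm_bv1[OF x, of n] abs_le_norm_bv1[OF x, of "Suc n"]
      by simp
  qed
  then show ?thesis
    by (simp add: bv1_def comp_operator_def)
qed

text \<open>Sum the termwise estimate for \<open>w = x - y\<close>: its first part gives
  \<open>M\<close> times the variation of \<open>w\<close>. In the second,
  \<open>\<bar>w n\<bar>\<close> is replaced by the norm of \<open>w\<close>, leaving the variations
  of \<open>x\<close> and \<open>y\<close>, each at most \<open>r\<close>; hence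
  \<open>2 * L * r\<close>.\<close>

lemma norm_bv1_comp_operator_diff_le:
  fixes f :: "real \<Rightarrow> real"
  assumes deriv: "\<And>x. (f has_real_derivative f' x) (at x)"
    and bd: "\<And>x. \<bar>x\<bar> \<le> r \<Longrightarrow> \<bar>f' x\<bar> \<le> M"
    and lip: "\<And>x y. \<bar>x\<bar> \<le> r \<Longrightarrow> \<bar>y\<bar> \<le> r \<Longrightarrow> \<bar>f' x - f' y\<bar> \<le> L * \<bar>x - y\<bar>"
    and "L \<ge> 0"
    and x: "x \<in> bv1" "norm_bv1 x \<le> r" and y: "y \<in> bv1" "norm_bv1 y \<le> r"
  shows "norm_bv1 (comp_operator f x - comp_operator f y) \<le> (M + 2 * L * r) * norm_bv1 (x - y)"
proof -
  define w where "w = x - y"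
  have w: "w \<in> bv1"
    using x y by (simp add: w_def bv1_diff)
  have xr: "\<bar>x n\<bar> \<le> r" and yr: "\<bar>y n\<bar> \<le> r" for n
    using abs_le_norm_bv1[of x n] abs_le_norm_bv1[of y n] x y by auto
  define B where "B n = M * \<bar>w (Suc n) - w n\<bar>
    + L * norm_bv1 w * (\<bar>x (Suc n) - x n\<bar> + \<bar>y (Suc n) - y n\<bar>)" for n
  have sums: "summable (\<lambda>n. \<bar>w (Suc n) - w n\<bar>)" "summable (\<lambda>n. \<bar>x (Suc n) - x n\<bar>)"
      "summable (\<lambda>n. \<bar>y (Suc n) - y n\<bar>)"
    using w x y by (auto simp: bv1_def)
  have "B sums (M * (\<Sum>n. \<bar>w (Suc n) - w n\<bar>)
      + L * norm_bv1 w * ((\<Sum>n. \<bar>x (Suc n) - x n\<bar>) + (\<Sum>n. \<bar>y (Suc n) - y n\<bar>)))"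
    unfolding B_def by (intro sums_add sums_mult summable_sums sums)
  then have B: "summable B" "suminf B = M * (\<Sum>n. \<bar>w (Suc n) - w n\<bar>)
      + L * norm_bv1 w * ((\<Sum>n. \<bar>x (Suc n) - x n\<bar>) + (\<Sum>n. \<bar>y (Suc n) - y n\<bar>))"
    by (simp_all add: sums_iff)
  let ?z = "comp_operator f x - comp_operator f y"
  have le: "\<bar>?z (Suc n) - ?z n\<bar> \<le> B n" for n
  proof -
    \<comment> \<open>Here \<open>a\<close>, \<open>b\<close> are the entries of \<open>x\<close> at
      \<open>Suc n\<close> and \<open>n\<close>, and \<open>c\<close>, \<open>d\<close> those of
      \<open>y\<close>, so \<open>b - d\<close> is \<open>w n\<close>.\<close>
    have "\<bar>?z (Suc n) - ?z n\<bar> \<le> M * \<bar>w (Suc n) - w n\<bar>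
        + L * (\<bar>x (Suc n) - x n\<bar> + \<bar>y (Suc n) - y n\<bar>) * \<bar>w n\<bar>"
      using second_difference_le[OF deriv bd lip \<open>L \<ge> 0\<close> xr xr yr yr, of "Suc n" "Suc n" n n]
        second_difference_le[OF deriv bd lip \<open>L \<ge> 0\<close> xr[of "Suc n"] xr[of n] yr[of "Suc n"] yr[of n]]
      by (simp add: comp_operator_def w_def)
    also have "\<dots> \<le> M * \<bar>w (Suc n) - w n\<bar>
        + L * (\<bar>x (Suc n) - x n\<bar> + \<bar>y (Suc n) - y n\<bar>) * norm_bv1 w"
      using abs_le_norm_bv1[OF w] \<open>L \<ge> 0\<close> by (intro add_left_mono mult_left_mono) auto
    finally show ?thesis
      by (simp add: B_def mult_ac)
  qed
  have "summable (\<lambda>n. \<bar>?z (Suc n) - ?z n\<bar>)"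
    using B(1) by (rule summable_comparison_test'[where N = 0]) (use le in simp)
  then have "(\<Sum>n. \<bar>?z (Suc n) - ?z n\<bar>) \<le> suminf B"
    using le B(1) by (intro suminf_le) auto
  also have "\<dots> \<le> M * (\<Sum>n. \<bar>w (Suc n) - w n\<bar>) + L * norm_bv1 w * (r + r)"
    unfolding B(2) using x y \<open>L \<ge> 0\<close> norm_bv1_nonneg[OF w]
    by (intro add_left_mono mult_left_mono add_mono order_trans[OF variation_le_norm_bv1]) auto
  finally have "(\<Sum>n. \<bar>?z (Suc n) - ?z n\<bar>) \<le> \<dots>" .
  \<comment> \<open>The first entry is bounded with the same \<open>M\<close>, so that it joins the
    variation of \<open>w\<close> to form the full norm.\<close>
  moreover have "\<bar>?z 0\<bar> \<le> M * \<bar>w 0\<bar>"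
    using lipschitz_if_derivative_bound[OF deriv bd xr yr]
    by (simp add: comp_operator_def w_def)
  ultimately have "norm_bv1 ?z \<le> M * \<bar>w 0\<bar> + (M * (\<Sum>n. \<bar>w (Suc n) - w n\<bar>)
      + L * norm_bv1 w * (r + r))"
    unfolding norm_bv1_def[of ?z] by (rule add_mono[rotated])
  also have "\<dots> = (M + 2 * L * r) * norm_bv1 w"
    by (simp add: norm_bv1_def algebra_simps)
  finally show ?thesis
    by (simp add: w_def)
qed

lemma comp_operator_lipschitz_if_differentiable:
  fixes f :: "real \<Rightarrow> real"
  assumes diff: "f differentiable_on UNIV"
    and lip: "lipschitz_on_bounded_sets UNIV norm norm (deriv f)"
  shows "comp_operator f \<in> bv1 \<rightarrow> bv1"
    and "lipschitz_on_bounded_sets bv1 norm_bv1 norm_bv1 (comp_operator f)"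
proof -
  have deriv: "(f has_real_derivative deriv f a) (at a)" for a
    using diff by (simp add: differentiable_on_def DERIV_deriv_iff_real_differentiable)
  have ex: "\<exists>L M. L \<ge> 0 \<and> M \<ge> 0 \<and> (\<forall>x. \<bar>x\<bar> \<le> r \<longrightarrow> \<bar>deriv f x\<bar> \<le> M) \<and>
      (\<forall>x y. \<bar>x\<bar> \<le> r \<longrightarrow> \<bar>y\<bar> \<le> r \<longrightarrow> \<bar>deriv f x - deriv f y\<bar> \<le> L * \<bar>x - y\<bar>)" if "r > 0" for r
  proof -
    from lip that obtain L where "L \<ge> 0"
      and L: "\<And>x y. \<bar>x\<bar> \<le> r \<Longrightarrow> \<bar>y\<bar> \<le> r \<Longrightarrow> \<bar>deriv f x - deriv f y\<bar> \<le> L * \<bar>x - y\<bar>"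
      unfolding lipschitz_on_bounded_sets_def real_norm_def by (meson UNIV_I)
    \<comment> \<open>Comparison with the point 0 turns the Lipschitz condition into a bound on the
      derivative.\<close>
    have "\<bar>deriv f x\<bar> \<le> \<bar>deriv f 0\<bar> + L * r" if "\<bar>x\<bar> \<le> r" for x
      using L[of x 0] that mult_left_mono[OF that \<open>L \<ge> 0\<close>] \<open>r > 0\<close> by simp
    then show ?thesis
      using L \<open>L \<ge> 0\<close> \<open>r > 0\<close>
      by (intro exI[of _ L] exI[of _ "\<bar>deriv f 0\<bar> + L * r"]) auto
  qed
  show "comp_operator f \<in> bv1 \<rightarrow> bv1"
  proof
    fix x
    assume "x \<in> bv1"
    then show "comp_operator f x \<in> bv1"
    proof (rule comp_operator_bv1[rotated])
      fix r :: real
      assume "r > 0"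
      from ex[OF this] show "\<exists>M. \<forall>a b. \<bar>a\<bar> \<le> r \<longrightarrow> \<bar>b\<bar> \<le> r \<longrightarrow> \<bar>f a - f b\<bar> \<le> M * \<bar>a - b\<bar>"
        using lipschitz_if_derivative_bound[OF deriv] by metis
    qed
  qed
  show "lipschitz_on_bounded_sets bv1 norm_bv1 norm_bv1 (comp_operator f)"
    unfolding lipschitz_on_bounded_sets_def
  proof (intro allI impI)
    fix r :: real
    assume "r > 0"
    from ex[OF this] obtain L M where "L \<ge> 0" "M \<ge> 0"
      and M: "\<And>x. \<bar>x\<bar> \<le> r \<Longrightarrow> \<bar>deriv f x\<bar> \<le> M"
      and L: "\<And>x y. \<bar>x\<bar> \<le> r \<Longrightarrow> \<bar>y\<bar> \<le> r \<Longrightarrow> \<bar>deriv f x - deriv f y\<bar> \<le> L * \<bar>x - y\<bar>"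
      by blast
    show "\<exists>L\<ge>0. \<forall>x\<in>bv1. \<forall>y\<in>bv1. norm_bv1 x \<le> r \<longrightarrow> norm_bv1 y \<le> r \<longrightarrow>
        norm_bv1 (comp_operator f x - comp_operator f y) \<le> L * norm_bv1 (x - y)"
      using norm_bv1_comp_operator_diff_le[OF deriv M L \<open>L \<ge> 0\<close>] \<open>L \<ge> 0\<close> \<open>M \<ge> 0\<close> \<open>r > 0\<close>
      by (intro exI[of _ "M + 2 * L * r"]) auto
  qed
qed

theorem theorem35:
  fixes f :: "real \<Rightarrow> real"
  shows "(comp_operator f \<in> bv1 \<rightarrow> bv1 \<and>
          lipschitz_on_bounded_sets bv1 norm_bv1 norm_bv1 (comp_operator f)) \<longleftrightarrow>
         (f differentiable_on UNIV \<and>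
          lipschitz_on_bounded_sets UNIV norm norm (deriv f))"
  using differentiable_if_comp_operator_lipschitz comp_operator_lipschitz_if_differentiable
  by blast

end
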